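(* Let $\Lambda$ be a non-ordinary acute numerical semigroup with enumeration $\lambda$, conductor $c$, subconductor $c'$ and dominant $d$. Let $$m=\min\{\lambda^{-1}(c+c'-2),\ \lambda^{-1}(2d)\}.$$ Then $m$ is the smallest integer for which $d_{ORD}(C_i)=\nu_{i+1}$ for all $i\geq m$.
   Context: $\mathbb{N}_0$ is the set of non-negative integers. A numerical semigroup is a subset $\Lambda\subseteq\mathbb{N}_0$ containing $0$, closed under addition, with finite complement in $\mathbb{N}_0$. Elements of $\mathbb{N}_0\setminus\Lambda$ are gaps. The conductor is the unique $c\in\Lambda$ with $c-1\notin\Lambda$ and $c+\mathbb{N}_0\subseteq\Lambda$. The enumeration of $\Lambda$ is the unique increasing bijection $\lambda:\mathbb{N}_0\to\Lambda$, written $\lambda_i=\lambda(i)$. For $i\in\mathbb{N}_0$, $\nu_i=\#\{j\in\mathbb{N}_0\mid\lambda_i-\lambda_j\in\Lambda\}$. The order bound (on the minimum distance of the $i$-th one-point Goppa code $C_i$ with associated semigroup $\Lambda$) is a quantity depending only on $\Lambda$ and $i\in\mathbb{N}_0$, defined by $d_{ORD}(C_i)=\min\{\nu_j\mid j>i\}$. $\Lambda$ is ordinary if $\Lambda=\{0\}\cup\{i\in\mathbb{N}_0\mid i\geq c\}$ for some non-negative integer $c$. For $\Lambda\neq\mathbb{N}_0$, the dominant is $d=\lambda_{\lambda^{-1}(c)-1}$ (the largest non-gap smaller than the conductor). Let $g(i)$ be the number of gaps smaller than $\lambda_i$. The subconductor is $c'=\lambda_i$, where $i$ is the smallest integer with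 $g(i)=g(\lambda^{-1}(d))$. If $\Lambda$ is non-ordinary (in which case $c'>0$), the subdominant is $d'=\lambda_{i-1}$, where $c'=\lambda_i$. $\Lambda$ is acute if it is ordinary, or if it is non-ordinary and $c-d\leq c'-d'$. *)

theory Defs
  imports Main "HOL-Library.Infinite_Set"
begin

definition numerical_semigroup :: "nat set \<Rightarrow> bool" where
  "numerical_semigroup \<Lambda> \<longleftrightarrow>
     0 \<in> \<Lambda> \<and> (\<forall>x\<in>\<Lambda>. \<forall>y\<in>\<Lambda>. x + y \<in> \<Lambda>) \<and> finite (- \<Lambda>)"

text \<open>
  The enumeration of \<open>\<Lambda>\<close> is the library function \<^const>\<open>enumerate\<close>, which for an infinite
  set of naturals is its increasing bijection from the naturals. The inverse is only
  meaningful on elements of \<open>\<Lambda>\<close>.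
\<close>

definition index_of :: "nat set \<Rightarrow> nat \<Rightarrow> nat" where
  "index_of \<Lambda> = inv (enumerate \<Lambda>)"

text \<open>For \<open>c = 0\<close> the number \<open>c - 1\<close> is negative, hence not in \<open>\<Lambda>\<close>; the guard prevents truncation.\<close>

definition conductor :: "nat set \<Rightarrow> nat" where
  "conductor \<Lambda> = (THE c. c \<in> \<Lambda> \<and> (0 < c \<longrightarrow> c - 1 \<notin> \<Lambda>) \<and> (\<forall>n. c + n \<in> \<Lambda>))"

text \<open>The condition \<open>\<lambda>\<^sub>j \<le> \<lambda>\<^sub>i\<close> says that the difference is non-negative, as truncated subtraction would give 0.\<close>

definition nu :: "nat set \<Rightarrow> nat \<Rightarrow> nat" where
  "nu \<Lambda> i = card {j. enumerate \<Lambda> j \<le> enumerate \<Lambda> i \<and> enumerate \<Lambda> i - enumerate \<Lambda> j \<in> \<Lambda>}"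

text \<open>The set is infinite in its index \<open>j\<close>, so the minimum is an infimum in the naturals (always attained).\<close>

definition order_bound :: "nat set \<Rightarrow> nat \<Rightarrow> nat" where
  "order_bound \<Lambda> i = Inf {nu \<Lambda> j | j. j > i}"

definition ordinary :: "nat set \<Rightarrow> bool" where
  "ordinary \<Lambda> \<longleftrightarrow> (\<exists>c. \<Lambda> = {0} \<union> {i. i \<ge> c})"

definition dominant :: "nat set \<Rightarrow> nat" where
  "dominant \<Lambda> = enumerate \<Lambda> (index_of \<Lambda> (conductor \<Lambda>) - 1)"

definition gaps_below :: "nat set \<Rightarrow> nat \<Rightarrow> nat" where
  "gaps_below \<Lambda> i = card {x. x \<notin> \<Lambda> \<and> x < enumerate \<Lambda> i}"

definition subconductor :: "nat set \<Rightarrow> nat" where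
  "subconductor \<Lambda> =
     enumerate \<Lambda> (LEAST i. gaps_below \<Lambda> i = gaps_below \<Lambda> (index_of \<Lambda> (dominant \<Lambda>)))"

definition subdominant :: "nat set \<Rightarrow> nat" where
  "subdominant \<Lambda> = enumerate \<Lambda> (index_of \<Lambda> (subconductor \<Lambda>) - 1)"

text \<open>In the non-ordinary case the dominant is below the conductor and the subdominant below
  the subconductor, so no subtraction truncates.\<close>

definition acute :: "nat set \<Rightarrow> bool" where
  "acute \<Lambda> \<longleftrightarrow> ordinary \<Lambda> \<or>
     (\<not> ordinary \<Lambda> \<and> conductor \<Lambda> - dominant \<Lambda> \<le> subconductor \<Lambda> - subdominant \<Lambda>)"

end

theory Submission
  imports Defs
begin

text \<open>
  For a non-gap \<open>x \<ge> c\<close>, inclusion-exclusion gives \<open>\<nu> = x + 1 - 2 g + G(x)\<close>, where \<open>g\<close> is the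
  genus and \<open>G(x)\<close> counts the ordered pairs of gaps with sum \<open>x\<close>. Let \<open>M\<close> be the smaller of
  \<open>c + c' - 2\<close> and \<open>2 d\<close>. For \<open>x \<ge> M\<close>, acuteness confines such pairs to the
  two topmost runs of gaps, \<open>(d',c')\<close> and \<open>(d,c)\<close>: \<open>2 (c + c' - 1 - x)\<close> of them use both runs,
  the others only the last one. Hence \<open>G\<close> drops by exactly \<open>2\<close> from \<open>M\<close> to \<open>M + 1\<close>, and by at
  most \<open>1\<close> at every later step, so \<open>\<nu>\<close> decreases at \<open>M\<close> and never afterwards.
\<close>

subsection \<open>Sums of two non-gaps and sums of two gaps\<close>

definition summands :: "nat set \<Rightarrow> nat \<Rightarrow> nat set" where
  "summands A x = {y \<in> A. y \<le> x \<and> x - y \<in> A}"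

text \<open>A number \<open>y <= x\<close> fails to be a summand exactly when \<open>y\<close> or
  its mirror image \<open>x - y\<close> is a gap. There are \<open>card (- A)\<close> of each kind,
  since the hypothesis keeps truncated subtraction injective on the gaps, and the two kinds overlap
  in \<open>summands (- A) x\<close>.\<close>

lemma card_summands_compl:
  fixes A :: "nat set"
  assumes "- A \<subseteq> {..x}"
  shows "card (summands A x) + 2 * card (- A) = x + 1 + card (summands (- A) x)"
proof -
  let ?R = "(\<lambda>y. x - y) ` (- A)"
  have fin: "finite (- A)"
    using assms finite_subset by blast
  have inj: "inj_on (\<lambda>y. x - y) (- A)"
    using assms by (intro inj_onI) (metis atMost_iff diff_diff_cancel subsetD)
  have R: "?R = {y. y \<le> x \<and> x - y \<notin> A}"
  proof (intro set_eqI iffI)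
    fix y assume "y \<in> {y. y \<le> x \<and> x - y \<notin> A}"
    then show "y \<in> ?R" by (intro image_eqI[of _ _ "x - y"]) auto
  next
    fix y assume "y \<in> ?R"
    then show "y \<in> {y. y \<le> x \<and> x - y \<notin> A}" using assms by fastforce
  qed
  have meet: "- A \<inter> ?R = summands (- A) x"
    unfolding R summands_def by auto
  have split: "{..x} = summands A x \<union> (- A \<union> ?R)" "summands A x \<inter> (- A \<union> ?R) = {}"
    using assms unfolding R summands_def by auto
  have "x + 1 = card (summands A x) + card (- A \<union> ?R)"
    using split fin card_Un_disjoint[of "summands A x" "- A \<union> ?R"]
    by (metis card_atMost Suc_eq_plus1 finite_Un finite_atMost)
  moreover have "card (- A) + card ?R = card (- A \<union> ?R) + card (- A \<inter> ?R)"
    using fin by (intro card_Un_Int) auto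
  ultimately show ?thesis
    using card_image[OF inj] meet by simp
qed

lemma card_gap_summands:
  fixes A :: "nat set" and c d c' d' x :: nat
  assumes top: "\<And>y. c \<le> y \<Longrightarrow> y \<in> A"
    and gaps1: "\<And>y. d < y \<Longrightarrow> y < c \<Longrightarrow> y \<notin> A"
    and run: "\<And>y. c' \<le> y \<Longrightarrow> y \<le> d \<Longrightarrow> y \<in> A"
    and gaps2: "\<And>y. d' < y \<Longrightarrow> y < c' \<Longrightarrow> y \<notin> A"
    and ord: "d' + 2 \<le> c'" "c' \<le> d" "d + 2 \<le> c"
    and acute: "c + d' \<le> c' + d"
    and x: "min (c + c' - 2) (2 * d) \<le> x"
  shows "card (summands (- A) x) =
    2 * (c + c' - 1 - x) + (min c (x - d) - max (d + 1) (x + 1 - c))"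
proof -
  let ?P = "{x + 1 - c..<c'}" and ?Q = "{x + 1 - c'..<c}"
    and ?H = "{max (d + 1) (x + 1 - c)..<min c (x - d)}"
  \<comment> \<open>\<open>mid\<close> excludes two gaps both below \<open>c'\<close>.
    \<open>low\<close> forces the partner of a gap in (d, c) above \<open>d'\<close>; when the
    minimum is \<open>2 * d\<close>, this is where acuteness enters.\<close>
  have low: "c + d' \<le> x" and mid: "d + c' \<le> x"
    using x ord acute by (auto simp: min_def split: if_splits)
  have gap_cases: "y < c' \<or> d < y \<and> y < c" if "y \<notin> A" for y
    using that top run by (meson not_le)
  \<comment> \<open>\<open>?P\<close> and \<open>?Q\<close> collect the pairs using both runs, with
    the member of the lower run first or second; \<open>?H\<close> collects the pairs inside (d,
    c).\<close>
  have "summands (- A) x = ?P \<union> ?Q \<union> ?H"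
  proof (intro set_eqI iffI)
    fix y assume "y \<in> summands (- A) x"
    then have y: "y \<notin> A" "x - y \<notin> A" "y \<le> x" by (auto simp: summands_def)
    from gap_cases[OF y(1)] gap_cases[OF y(2)] y(3) low mid ord
    show "y \<in> ?P \<union> ?Q \<union> ?H" by auto
  next
    fix y assume "y \<in> ?P \<union> ?Q \<union> ?H"
    then consider "y \<in> ?P" | "y \<in> ?Q" | "y \<in> ?H" by blast
    then show "y \<in> summands (- A) x"
    proof cases
      case 1
      then have "d' < y" "y < c'" "d < x - y" "x - y < c" "y \<le> x"
        using low mid ord by auto
      then show ?thesis using gaps1 gaps2 by (simp add: summands_def)
    next
      case 2
      then have "d < y" "y < c" "d' < x - y" "x - y < c'" "y \<le> x"
        using low mid ord by auto
      then show ?thesis using gaps1 gaps2 by (simp add: summands_def)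
    next
      case 3
      then have "d < y" "y < c" "d < x - y" "x - y < c" "y \<le> x"
        using low mid ord by auto
      then show ?thesis using gaps1 by (simp add: summands_def)
    qed
  qed
  moreover have "?P \<inter> ?Q = {}" "(?P \<union> ?Q) \<inter> ?H = {}"
    using mid ord by auto
  ultimately have "card (summands (- A) x) = card ?P + card ?Q + card ?H"
    by (simp add: card_Un_disjoint)
  moreover have "card ?P = c + c' - 1 - x" "card ?Q = c + c' - 1 - x"
    using low mid ord by auto
  ultimately show ?thesis by simp
qed

text \<open>The term \<open>x + 1\<close> in \<open>card_summands_compl\<close> grows by one per
  step, so the number of non-gap pairs falls exactly when the number of gap pairs loses at least
  two.\<close>

lemma card_summands_step:
  fixes A :: "nat set" and c d c' d' x :: nat
  assumes top: "\<And>y. c \<le> y \<Longrightarrow> y \<in> A"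
    and gaps1: "\<And>y. d < y \<Longrightarrow> y < c \<Longrightarrow> y \<notin> A"
    and run: "\<And>y. c' \<le> y \<Longrightarrow> y \<le> d \<Longrightarrow> y \<in> A"
    and gaps2: "\<And>y. d' < y \<Longrightarrow> y < c' \<Longrightarrow> y \<notin> A"
    and ord: "d' + 2 \<le> c'" "c' \<le> d" "d + 2 \<le> c"
    and acute: "c + d' \<le> c' + d"
  defines "M \<equiv> min (c + c' - 2) (2 * d)"
  shows "M < x \<Longrightarrow> card (summands A x) \<le> card (summands A (x + 1))"
    and "card (summands A (M + 1)) < card (summands A M)"
proof -
  have Mc: "c \<le> M"
    using ord acute by (auto simp: M_def)
  define mixed where "mixed = (\<lambda>y. c + c' - 1 - y)"
  define upper where "upper = (\<lambda>y. min c (y - d) - max (d + 1) (y + 1 - c))"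
  have nongap: "card (summands A y) + 2 * card (- A) = y + 1 + (2 * mixed y + upper y)"
    if "M \<le> y" for y
  proof -
    have "card (summands (- A) y) = 2 * mixed y + upper y"
      using that unfolding M_def mixed_def upper_def
      by (intro card_gap_summands[OF top gaps1 run gaps2 ord acute]) auto
    moreover have "- A \<subseteq> {..y}"
      using top that Mc by (metis ComplD atMost_iff le_trans linorder_le_cases subsetI)
    ultimately show ?thesis using card_summands_compl by metis
  qed
  show "card (summands A x) \<le> card (summands A (x + 1))" if x: "M < x"
  proof -
    have "2 * mixed x + upper x \<le> 2 * mixed (x + 1) + upper (x + 1) + 1"
    proof (cases "c + c' \<le> x + 1")
      \<comment> \<open>\<open>mixed\<close> is 0 at \<open>x\<close> and \<open>x + 1\<close>; in
        \<open>upper\<close> the right end never moves back and the left end advances by at most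
        one.\<close>
      case True
      have "min c (x - d) \<le> min c (x + 1 - d)"
        by (intro min.mono) auto
      moreover have "max (d + 1) (x + 1 + 1 - c) \<le> max (d + 1) (x + 1 - c) + 1"
        by (intro max.boundedI) (auto simp: max_def)
      moreover have "a - q \<le> b - p + 1" if "a \<le> b" "p \<le> q + 1" for a b p q :: nat
        using that by simp
      ultimately have "upper x \<le> upper (x + 1) + 1"
        unfolding upper_def by blast
      then show ?thesis using True by (simp add: mixed_def)
    next
      case False
      \<comment> \<open>Here \<open>x\<close> is at most \<open>c + c' - 2\<close>, so
        \<open>M < x\<close> forces \<open>M = 2 * d\<close>. Then \<open>2 * mixed\<close> loses
        two while \<open>upper\<close> gains one.\<close>
      then have "2 * d < x" using x by (auto simp: M_def)
      moreover have "min c (x - d) = x - d" "min c (x + 1 - d) = x + 1 - d"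
        "max (d + 1) (x + 1 - c) = d + 1" "max (d + 1) (x + 1 + 1 - c) = d + 1"
        using False ord by auto
      ultimately show ?thesis using False by (simp add: upper_def mixed_def)
    qed
    then show ?thesis using nongap[of x] nongap[of "x + 1"] x by linarith
  qed
  \<comment> \<open>The bound \<open>2 * d\<close> keeps \<open>upper\<close> empty even at
    \<open>M + 1\<close>; the bound \<open>c + c' - 2\<close> keeps \<open>mixed M\<close> positive,
    so its decrease is not truncated.\<close>
  have "M \<le> 2 * d" "M \<le> c + c' - 2" by (simp_all add: M_def)
  then have "upper M = 0" "upper (M + 1) = 0" "mixed M = mixed (M + 1) + 1"
    using ord unfolding upper_def mixed_def by (auto simp: min.coboundedI2 max.coboundedI1)
  then show "card (summands A (M + 1)) < card (summands A M)"
    using nongap[of M] nongap[of "M + 1"] by linarith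
qed

subsection \<open>Enumerations of sets of natural numbers\<close>

lemma enumerate_index_of:
  assumes "infinite A" and "x \<in> A"
  shows "enumerate A (index_of A x) = x"
  using assms by (simp add: index_of_def f_inv_into_f range_enumerate)

lemma index_of_enumerate:
  assumes "infinite A"
  shows "index_of A (enumerate A i) = i"
  unfolding index_of_def
  using strict_mono_imp_inj_on[OF strict_mono_enumerate[OF assms]] by (rule inv_f_f)

lemma between_enumerate_notin:
  fixes A :: "nat set"
  assumes "infinite A" and "enumerate A i < x" and "x < enumerate A (Suc i)"
  shows "x \<notin> A"
proof
  assume "x \<in> A"
  then obtain j where "enumerate A j = x"
    using enumerate_Ex[OF assms(1)] by blast
  then show False using assms by auto
qed

lemma enumerate_Suc_eq:
  fixes A :: "nat set"
  assumes "infinite A" and "Suc (enumerate A i) \<in> A"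
  shows "enumerate A (Suc i) = Suc (enumerate A i)"
proof -
  have "enumerate A i < enumerate A (Suc i)"
    using assms(1) by (intro enumerate_mono) auto
  moreover have "\<not> Suc (enumerate A i) < enumerate A (Suc i)"
    using between_enumerate_notin[OF assms(1), of i] assms(2) by blast
  ultimately show ?thesis by simp
qed

lemma nu_eq_card_summands:
  assumes "infinite A"
  shows "nu A i = card (summands A (enumerate A i))"
proof -
  let ?J = "{j. enumerate A j \<le> enumerate A i \<and> enumerate A i - enumerate A j \<in> A}"
  have "inj_on (enumerate A) ?J"
    using strict_mono_imp_inj_on[OF strict_mono_enumerate[OF assms]]
    by (rule inj_on_subset) (rule subset_UNIV)
  moreover have "summands A (enumerate A i) = enumerate A ` ?J"
  proof (intro subset_antisym subsetI)
    fix y assume y: "y \<in> summands A (enumerate A i)"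
    then have "y \<in> A" by (simp add: summands_def)
    then obtain j where "enumerate A j = y"
      using enumerate_Ex[OF assms] by blast
    with y show "y \<in> enumerate A ` ?J"
      by (intro image_eqI[of _ _ j]) (simp_all add: summands_def)
  next
    fix y assume "y \<in> enumerate A ` ?J"
    then obtain j where "y = enumerate A j" "j \<in> ?J" by (rule imageE)
    then show "y \<in> summands A (enumerate A i)"
      using enumerate_in_set[OF assms] by (simp add: summands_def)
  qed
  ultimately show ?thesis
    unfolding nu_def by (simp only: card_image)
qed

lemma order_bound_le:
  assumes "i < j"
  shows "order_bound A i \<le> nu A j"
  unfolding order_bound_def using assms by (intro cInf_lower) auto

text \<open>Only indices beyond \<open>i\<close> are compared, so a drop of \<open>nu\<close> from
  \<open>i\<close> to \<open>Suc i\<close> is harmless. This is what admits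
  \<open>i = m\<close>.\<close>

lemma order_bound_eq_nu:
  assumes "\<And>j. i < j \<Longrightarrow> nu A j \<le> nu A (Suc j)"
  shows "order_bound A i = nu A (Suc i)"
proof -
  have "nu A (Suc i) \<le> nu A j" if "Suc i \<le> j" for j
    using that 
  proof (induction rule: dec_induct)
    case (step n)
    then show ?case using assms[of n] by simp
  qed simp
  then show ?thesis
    unfolding order_bound_def by (intro cInf_eq_minimum) auto
qed

subsection \<open>Conductor, dominant, subconductor and subdominant\<close>

lemma numerical_semigroup_infinite:
  assumes "numerical_semigroup A"
  shows "infinite A"
  using assms unfolding numerical_semigroup_def
  by (auto simp: finite_compl)

lemma conductor_props:
  assumes "numerical_semigroup A" and "\<not> ordinary A"
  shows "0 < conductor A" and "conductor A - 1 \<notin> A"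
    and "\<And>y. conductor A \<le> y \<Longrightarrow> y \<in> A"
proof -
  let ?P = "\<lambda>c. c \<in> A \<and> (0 < c \<longrightarrow> c - 1 \<notin> A) \<and> (\<forall>n. c + n \<in> A)"
  obtain b where b: "\<forall>n. b + n \<in> A"
    using assms(1) unfolding numerical_semigroup_def
    by (metis ComplI finite_nat_set_iff_bounded not_add_less1)
  define c where "c = (LEAST c. \<forall>n. c + n \<in> A)"
  have c: "\<forall>n. c + n \<in> A"
    unfolding c_def using b by (rule LeastI)
  have pred: "c - 1 \<notin> A" if "0 < c"
  proof
    assume "c - 1 \<in> A"
    then have "\<forall>n. (c - 1) + n \<in> A"
      using c that
      by (metis Nat.add_0_right Suc_diff_1 add_Suc_shift not0_implies_Suc)
    then have "c \<le> c - 1"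
      unfolding c_def by (rule Least_le)
    with that show False by simp
  qed
  have "?P c" using c pred by (metis add_0_right)
  \<comment> \<open>Of two distinct candidates, the tail of the smaller contains the predecessor of
    the larger.\<close>
  moreover have "a = c" if "?P a" for a
  proof (rule ccontr)
    assume "a \<noteq> c"
    then consider "a < c" | "c < a" by linarith
    then show False
    proof cases
      case 1
      then have "c - 1 = a + (c - 1 - a)" by simp
      then show False using that pred 1 by (metis less_nat_zero_code neq0_conv)
    next
      case 2
      then have "a - 1 = c + (a - 1 - c)" by simp
      then show False using that c 2 by (metis less_nat_zero_code neq0_conv)
    qed
  qed
  ultimately have eq: "conductor A = c"
    unfolding conductor_def by (intro the_equality)
  show top: "y \<in> A" if "conductor A \<le> y" for y
    using c that eq le_Suc_ex by blast
  show "0 < conductor A"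
  proof (rule ccontr)
    assume "\<not> 0 < conductor A"
    then have "A = {0} \<union> {i. i \<ge> 0}" using top by auto
    then show False using assms(2) unfolding ordinary_def by blast
  qed
  then show "conductor A - 1 \<notin> A" using pred eq by simp
qed

lemma dominant_props:
  assumes "numerical_semigroup A" and "\<not> ordinary A"
  shows "dominant A \<in> A" and "0 < dominant A" and "dominant A < conductor A"
    and "\<And>y. dominant A < y \<Longrightarrow> y < conductor A \<Longrightarrow> y \<notin> A"
proof -
  note inf = numerical_semigroup_infinite[OF assms(1)]
  note con = conductor_props[OF assms]
  let ?k = "index_of A (conductor A)"
  have k: "enumerate A ?k = conductor A"
    using enumerate_index_of[OF inf con(3)] by simp
  have zero: "0 \<in> A" using assms(1) by (simp add: numerical_semigroup_def)
  have "enumerate A 0 = 0"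
    using zero unfolding enumerate_0 by (intro Least_eq_0)
  with k con(1) have "?k \<noteq> 0" by (metis less_irrefl)
  then have Suc: "Suc (?k - 1) = ?k" by simp
  show "dominant A \<in> A"
    unfolding dominant_def using inf by (rule enumerate_in_set)
  show lt: "dominant A < conductor A"
    unfolding dominant_def using enumerate_mono[of "?k - 1" ?k A] inf k Suc by simp
  show gaps: "y \<notin> A" if "dominant A < y" "y < conductor A" for y
    using between_enumerate_notin[OF inf, of "?k - 1" y] that k Suc
    unfolding dominant_def by simp
  show "0 < dominant A"
  proof (rule ccontr)
    assume "\<not> 0 < dominant A"
    \<comment> \<open>With dominant 0, no non-gap lies strictly between 0 and the conductor, which
      is the ordinary case.\<close>
    then have "y \<in> A \<longleftrightarrow> y = 0 \<or> conductor A \<le> y" for y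
      using gaps[of y] con(3)[of y] zero by (cases "conductor A \<le> y") auto
    then have "A = {0} \<union> {i. i \<ge> conductor A}" by blast
    then show False using assms(2) unfolding ordinary_def by blast
  qed
qed

text \<open>Equal gap counts mean that no gap lies between, so the least such index marks the start
  of the run of consecutive non-gaps ending at the dominant. If its predecessor were a non-gap, it
  would have the same gap count at a smaller index.\<close>

lemma subconductor_props:
  assumes "numerical_semigroup A" and "\<not> ordinary A"
  shows "subconductor A \<le> dominant A"
    and "\<And>y. subconductor A \<le> y \<Longrightarrow> y \<le> dominant A \<Longrightarrow> y \<in> A"
    and "0 < subconductor A" and "subconductor A - 1 \<notin> A"
    and "subdominant A < subconductor A" and "subdominant A \<in> A"
    and "\<And>y. subdominant A < y \<Longrightarrow> y < subconductor A \<Longrightarrow> y \<notin> A"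
proof -
  note inf = numerical_semigroup_infinite[OF assms(1)]
  note dom = dominant_props[OF assms]
  let ?d = "index_of A (dominant A)"
  have d: "enumerate A ?d = dominant A"
    using enumerate_index_of[OF inf dom(1)] .
  define i where "i = (LEAST i. gaps_below A i = gaps_below A ?d)"
  have i: "enumerate A i = subconductor A"
    unfolding i_def subconductor_def ..
  have gi: "gaps_below A i = gaps_below A ?d"
    unfolding i_def by (rule LeastI) (rule refl)
  have "i \<le> ?d"
    unfolding i_def by (rule Least_le) (rule refl)
  then show le: "subconductor A \<le> dominant A"
    using i d inf by (metis enumerate_mono_le_iff)
  have "{x. x \<notin> A \<and> x < subconductor A} = {x. x \<notin> A \<and> x < dominant A}"
    using gi le unfolding gaps_below_def i d by (intro card_subset_eq) auto
  then show run: "y \<in> A" if "subconductor A \<le> y" "y \<le> dominant A" for y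
    using that dom(1) by (metis (mono_tags, lifting) le_neq_implies_less mem_Collect_eq not_le)
  show pos: "0 < subconductor A"
  proof (rule ccontr)
    assume "\<not> 0 < subconductor A"
    \<comment> \<open>A run starting at 0 would contain 1, which generates everything and leaves no
      gap below the conductor.\<close>
    then have one: "1 \<in> A" using run[of 1] dom(2) by simp
    have "n \<in> A" for n
    proof (induction n)
      case 0
      show ?case using assms(1) by (simp add: numerical_semigroup_def)
    next
      case (Suc n)
      then show ?case using assms(1) one unfolding numerical_semigroup_def
        by (metis Suc_eq_plus1)
    qed
    then show False using conductor_props(2)[OF assms] by blast
  qed
  show pred: "subconductor A - 1 \<notin> A"
  proof
    assume "subconductor A - 1 \<in> A"
    then obtain k where k: "enumerate A k = subconductor A - 1"
      using inf enumerate_Ex by metis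
    have "{x. x \<notin> A \<and> x < subconductor A - 1} = {x. x \<notin> A \<and> x < subconductor A}"
    proof -
      have "x < subconductor A - 1" if "x \<notin> A" "x < subconductor A" for x
        using that \<open>subconductor A - 1 \<in> A\<close> by (cases "x = subconductor A - 1") auto
      then show ?thesis by auto
    qed
    then have "gaps_below A k = gaps_below A ?d"
      using gi unfolding gaps_below_def k i by simp
    then have "i \<le> k"
      unfolding i_def by (rule Least_le)
    then have "enumerate A i \<le> enumerate A k"
      using inf by simp
    then show False using k i pos by simp
  qed
  have "i \<noteq> 0"
  proof
    assume "i = 0"
    then have "enumerate A i = 0"
      using assms(1) by (auto simp: numerical_semigroup_def enumerate_0 intro: Least_eq_0)
    then show False using i pos by simp
  qed
  then have Suc: "Suc (i - 1) = i" by simp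
  have sub: "subdominant A = enumerate A (i - 1)"
    unfolding subdominant_def using index_of_enumerate[OF inf, of i] i by simp
  show "subdominant A \<in> A"
    unfolding sub using inf by (rule enumerate_in_set)
  show "subdominant A < subconductor A"
    unfolding sub using enumerate_mono[of "i - 1" i A] inf i Suc by simp
  show "y \<notin> A" if "subdominant A < y" "y < subconductor A" for y
    using between_enumerate_notin[OF inf, of "i - 1" y] that i Suc unfolding sub by simp
qed

section \<open>The threshold index, from integers back to indices\<close>

theorem corollary6p4:
  fixes \<Lambda> :: "nat set" and c c' d m :: nat
  assumes "numerical_semigroup \<Lambda>" and "\<not> ordinary \<Lambda>" and "acute \<Lambda>"
    and "c = conductor \<Lambda>" and "c' = subconductor \<Lambda>" and "d = dominant \<Lambda>"
    and "m = min (index_of \<Lambda> (c + c' - 2)) (index_of \<Lambda> (2 * d))"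
  shows "(\<forall>i\<ge>m. order_bound \<Lambda> i = nu \<Lambda> (i + 1)) \<and>
         (\<forall>k. (\<forall>i\<ge>k. order_bound \<Lambda> i = nu \<Lambda> (i + 1)) \<longrightarrow> m \<le> k)"
proof -
  define d' where "d' = subdominant \<Lambda>"
  define M where "M = min (c + c' - 2) (2 * d)"
  note inf = numerical_semigroup_infinite[OF assms(1)]
  note con = conductor_props[OF assms(1,2), folded assms(4)]
  note dom = dominant_props[OF assms(1,2), folded assms(4,6)]
  note sub = subconductor_props[OF assms(1,2), folded assms(5,6) d'_def]
  have "c - d \<le> c' - d'"
    using assms(2,3) unfolding acute_def assms(4-6) d'_def by simp
  then have acute: "c + d' \<le> c' + d"
    using dom(3) sub(5) by simp
  have "d \<noteq> c - 1" "d' \<noteq> c' - 1"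
    using con(2) dom(1) sub(4,6) by auto
  then have ord: "d' + 2 \<le> c'" "c' \<le> d" "d + 2 \<le> c"
    using dom(3) sub(1,5) by auto
  note step = card_summands_step[OF con(3) dom(4) sub(2,7) ord acute, folded M_def]
  \<comment> \<open>Both numbers are at least \<open>c\<close>: the first as \<open>c'\<close> is at
    least 2, the second by acuteness. Hence both indices are meaningful.\<close>
  have "c + c' - 2 \<in> \<Lambda>" "2 * d \<in> \<Lambda>"
    using con(3) ord acute by auto
  note idx = this[THEN enumerate_index_of[OF inf]]
  have m: "enumerate \<Lambda> m = M"
    unfolding M_def assms(7) using idx enumerate_mono_le_iff[OF inf]
    by (metis min_def)
  have M: "c \<le> M" using ord acute unfolding M_def by auto
  \<comment> \<open>Past the conductor, consecutive indices enumerate consecutive integers, so the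
    step from \<open>x\<close> to \<open>x + 1\<close> becomes a step of the index.\<close>
  have Suc: "enumerate \<Lambda> (Suc j) = enumerate \<Lambda> j + 1" if "m \<le> j" for j
  proof -
    have "M \<le> enumerate \<Lambda> j"
      using that m inf by (metis enumerate_mono_le_iff)
    then show ?thesis using enumerate_Suc_eq[OF inf] con(3) M by simp
  qed
  have incr: "nu \<Lambda> j \<le> nu \<Lambda> (Suc j)" if "m < j" for j
  proof -
    have "M < enumerate \<Lambda> j"
      using that m inf by (metis enumerate_mono)
    then show ?thesis using step(1) Suc that by (simp add: nu_eq_card_summands[OF inf])
  qed
  have decr: "nu \<Lambda> (Suc m) < nu \<Lambda> m"
    using step(2) Suc m by (simp add: nu_eq_card_summands[OF inf])
  have "order_bound \<Lambda> i = nu \<Lambda> (i + 1)" if "m \<le> i" for i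
    using that incr order_bound_eq_nu[of i \<Lambda>] by simp
  moreover have "m \<le> k" if k: "\<forall>i\<ge>k. order_bound \<Lambda> i = nu \<Lambda> (i + 1)" for k
  proof (rule ccontr)
    assume "\<not> m \<le> k"
    \<comment> \<open>The bound at \<open>m - 1\<close> also ranges over \<open>Suc m\<close>, where
      \<open>nu\<close> is already smaller than at \<open>m\<close>.\<close>
    then have "k \<le> m - 1" "Suc (m - 1) = m" by auto
    then have "order_bound \<Lambda> (m - 1) = nu \<Lambda> m" using k by simp
    moreover have "order_bound \<Lambda> (m - 1) \<le> nu \<Lambda> (Suc m)"
      by (rule order_bound_le) simp
    ultimately show False using decr by simp
  qed
  ultimately show ?thesis by blast
qed

end
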